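(* Every constructible graph is weakly cop-win.
   Context: Graphs are undirected and reflexive (there is a loop at every vertex); they may be infinite and need not be locally finite. Constructible: a vertex $\mu\neq\nu$ dominates $\nu$ in a graph if $\mu$ is adjacent to $\nu$ and to all neighbours of $\nu$. For a well order $<$ on the vertex set $V$ of $G$, $G_{\le\nu}$ denotes the subgraph of $G$ induced by $\{\gamma\in V:\gamma\le\nu\}$. $G$ is constructible if there is a well order $<$ on $V$ such that each vertex $\nu$ other than the least one is dominated in $G_{\le \nu}$ by some vertex of $G_{\le\nu}$. The game: two players, the cop and the robber, have perfect information and move in rounds $0,1,2,\dots$; the cop plays in even rounds, the robber in odd rounds. In round $0$ the cop chooses a starting vertex, in round $1$ the robber chooses a starting vertex; in each later round the player whose turn it is moves to a neighbour of their current vertex (because of the loops, staying put is allowed). The robber is caught (and the game ends) as soon as both players occupy the same vertex. A strategy of the cop is a choice of starting vertex together with a function $S\colon V\times V\to V$ assigning to $(c,r)$ a neighbour of $c$: when it is the cop's turn, the cop is at $c$ and the robber is at $r$, she moves to $S(c,r)$. A strategy of the cop is weakly winning if it prevents the robber from visiting any vertex infinitely often, i.e. in every play in which the cop follows the strategy, either the robber is caught after finitely many rounds or every vertex is occupied by the robber in only finitely many rounds. A graph is weakly cop-win if the cop has a weakly winning strategy on it. *)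

theory Defs
  imports Main
begin

text \<open>A graph is a vertex set \<open>V\<close> together with a symmetric, reflexive adjacency relation
  \<open>E\<close> on \<open>V\<close>. Graphs are nonempty, since otherwise no player could choose a starting vertex.
  There is no finiteness assumption of any kind.\<close>

definition graph :: "'a set \<Rightarrow> ('a \<times> 'a) set \<Rightarrow> bool" where
  "graph V E \<longleftrightarrow> V \<noteq> {} \<and> E \<subseteq> V \<times> V \<and> sym E \<and> (\<forall>v\<in>V. (v, v) \<in> E)"

definition dominates :: "'a set \<Rightarrow> ('a \<times> 'a) set \<Rightarrow> 'a \<Rightarrow> 'a \<Rightarrow> bool" where
  "dominates V E \<mu> \<nu> \<longleftrightarrow>
     \<mu> \<in> V \<and> \<nu> \<in> V \<and> \<mu> \<noteq> \<nu> \<and> (\<mu>, \<nu>) \<in> E \<and> (\<forall>w\<in>V. (\<nu>, w) \<in> E \<longrightarrow> (\<mu>, w) \<in> E)"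

definition induced_edges :: "('a \<times> 'a) set \<Rightarrow> 'a set \<Rightarrow> ('a \<times> 'a) set" where
  "induced_edges E U = E \<inter> U \<times> U"

text \<open>As usual in \<^theory>\<open>HOL.Order_Relation\<close>, the well order \<open>R\<close> is the reflexive one,
  so \<open>(\<gamma>, \<nu>) \<in> R\<close> means \<open>\<gamma> \<le> \<nu>\<close>.\<close>

definition down_set :: "'a set \<Rightarrow> ('a \<times> 'a) set \<Rightarrow> 'a \<Rightarrow> 'a set" where
  "down_set V R \<nu> = {\<gamma> \<in> V. (\<gamma>, \<nu>) \<in> R}"

definition constructible :: "'a set \<Rightarrow> ('a \<times> 'a) set \<Rightarrow> bool" where
  "constructible V E \<longleftrightarrow>
     (\<exists>R. well_order_on V R \<and>
        (\<forall>\<nu>\<in>V. \<not> (\<forall>\<gamma>\<in>V. (\<nu>, \<gamma>) \<in> R) \<longrightarrow>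
           (\<exists>\<mu>\<in>down_set V R \<nu>.
              dominates (down_set V R \<nu>) (induced_edges E (down_set V R \<nu>)) \<mu> \<nu>)))"

definition cop_strategy :: "'a set \<Rightarrow> ('a \<times> 'a) set \<Rightarrow> 'a \<Rightarrow> ('a \<times> 'a \<Rightarrow> 'a) \<Rightarrow> bool" where
  "cop_strategy V E c0 S \<longleftrightarrow> c0 \<in> V \<and> (\<forall>c\<in>V. \<forall>r\<in>V. (c, S (c, r)) \<in> E)"

text \<open>In a play, \<open>c k\<close> is the vertex chosen by the cop in round \<open>2 * k\<close> and \<open>r k\<close> the vertex
  chosen by the robber in round \<open>2 * k + 1\<close>. A play that ends by capture is represented by its
  arbitrary legal continuations, which always exist because of the loops; everything after the
  first capture is irrelevant for the outcome.\<close>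

definition play_following ::
  "'a set \<Rightarrow> ('a \<times> 'a) set \<Rightarrow> 'a \<Rightarrow> ('a \<times> 'a \<Rightarrow> 'a) \<Rightarrow> (nat \<Rightarrow> 'a) \<Rightarrow> (nat \<Rightarrow> 'a) \<Rightarrow> bool" where
  "play_following V E c0 S c r \<longleftrightarrow>
     c 0 = c0 \<and> (\<forall>k. c (Suc k) = S (c k, r k)) \<and>
     r 0 \<in> V \<and> (\<forall>k. (r k, r (Suc k)) \<in> E)"

text \<open>The positions occurring in a play are \<open>(c k, r k)\<close>, after round \<open>2 * k + 1\<close>, and
  \<open>(c (Suc k), r k)\<close>, after round \<open>2 * k + 2\<close>.\<close>

definition caught :: "(nat \<Rightarrow> 'a) \<Rightarrow> (nat \<Rightarrow> 'a) \<Rightarrow> bool" where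
  "caught c r \<longleftrightarrow> (\<exists>k. c k = r k \<or> c (Suc k) = r k)"

definition weakly_winning :: "'a set \<Rightarrow> ('a \<times> 'a) set \<Rightarrow> 'a \<Rightarrow> ('a \<times> 'a \<Rightarrow> 'a) \<Rightarrow> bool" where
  "weakly_winning V E c0 S \<longleftrightarrow>
     (\<forall>c r. play_following V E c0 S c r \<longrightarrow> caught c r \<or> (\<forall>v\<in>V. finite {k. r k = v}))"

definition weakly_cop_win :: "'a set \<Rightarrow> ('a \<times> 'a) set \<Rightarrow> bool" where
  "weakly_cop_win V E \<longleftrightarrow> (\<exists>c0 S. cop_strategy V E c0 S \<and> weakly_winning V E c0 S)"

end

theory Submission
  imports Defs
begin

text \<open>
  The construction order turns the graph into a rooted tree: the parent of a vertex \<open>v\<close> is a vertex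
  dominating \<open>v\<close> at the moment \<open>v\<close> is added. Since parents are smaller than their children in a
  well order, every vertex has only finitely many ancestors, although the order itself may be long.

  The cop starts at the root and always moves as close to the robber as possible along the chain of
  his ancestors. Suppose that she sits on an ancestor of the robber's position \<open>r\<close>, and let \<open>\<alpha>\<close>
  be the child of her position on the chain leading to \<open>r\<close>. Sending each vertex to its first
  ancestor below \<open>\<alpha>\<close> (inclusively) preserves adjacency (lemma \<open>shadow_adjacent\<close>), so when the
  robber moves to \<open>r'\<close>, the image \<open>b\<close> of \<open>r'\<close> is adjacent to \<open>\<alpha>\<close>, and hence to the cop's position,
  which dominates \<open>\<alpha>\<close>. She can therefore move at least as far as \<open>b\<close>, and if this does not catch
  the robber, then the child of her new position towards \<open>r'\<close> lies strictly above \<open>\<alpha>\<close>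
  (lemma \<open>front_advances\<close>).

  Thus the vertices \<open>\<alpha>\<close> strictly increase during a play without capture. As \<open>\<alpha>\<close> is an ancestor
  of the robber's current position, his visits to a fixed vertex \<open>v\<close> inject into the finite set of
  ancestors of \<open>v\<close>.
\<close>

text \<open>Making the root its own parent lets \<open>(p ^^ n) v\<close> run through the ancestors of \<open>v\<close> without
  case distinctions.\<close>

locale domination_tree =
  fixes V :: "'a set" and E R :: "('a \<times> 'a) set" and root :: 'a and p :: "'a \<Rightarrow> 'a"
  assumes graph: "graph V E"
    and well_order: "well_order_on V R"
    and root_in: "root \<in> V"
    and root_least: "v \<in> V \<Longrightarrow> (root, v) \<in> R"
    and parent_le: "v \<in> V \<Longrightarrow> (p v, v) \<in> R"
    and parent_fixed: "v \<in> V \<Longrightarrow> p v = v \<Longrightarrow> v = root"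
    and parent_dominates: "v \<in> V \<Longrightarrow> (v, w) \<in> E \<Longrightarrow> (w, v) \<in> R \<Longrightarrow> (p v, w) \<in> E"
begin

lemma edge_in: "(x, y) \<in> E \<Longrightarrow> x \<in> V \<and> y \<in> V"
  using graph by (auto simp: graph_def)

lemma edge_sym: "(x, y) \<in> E \<Longrightarrow> (y, x) \<in> E"
  using graph by (auto simp: graph_def dest: symD)

lemma edge_refl: "v \<in> V \<Longrightarrow> (v, v) \<in> E"
  using graph by (simp add: graph_def)

lemma le_trans: "(x, y) \<in> R \<Longrightarrow> (y, z) \<in> R \<Longrightarrow> (x, z) \<in> R"
  using well_order unfolding order_on_defs by (meson transD)

lemma le_antisym: "(x, y) \<in> R \<Longrightarrow> (y, x) \<in> R \<Longrightarrow> x = y"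
  using well_order unfolding order_on_defs by (meson antisymD)

lemma not_le: "x \<in> V \<Longrightarrow> y \<in> V \<Longrightarrow> (x, y) \<notin> R \<Longrightarrow> (y, x) \<in> R - Id"
  using well_order unfolding order_on_defs total_on_def
  by (metis Diff_iff pair_in_Id_conv refl_onD)

lemma less_trans: "(x, y) \<in> R - Id \<Longrightarrow> (y, z) \<in> R - Id \<Longrightarrow> (x, z) \<in> R - Id"
  by (auto intro: le_trans dest: le_antisym)

lemma le_less_trans: "(x, y) \<in> R \<Longrightarrow> (y, z) \<in> R - Id \<Longrightarrow> (x, z) \<in> R - Id"
  by (auto intro: le_trans dest: le_antisym)

lemma less_wf: "wf (R - Id)"
  using well_order by (simp add: well_order_on_def)

lemma parent_in: "v \<in> V \<Longrightarrow> p v \<in> V"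
  using well_order_on_domain[OF well_order parent_le] by simp

lemma ancestor_in: "v \<in> V \<Longrightarrow> (p ^^ n) v \<in> V"
  by (induction n) (simp_all add: parent_in)

lemma parent_root: "p root = root"
  by (rule le_antisym) (simp_all add: parent_le root_least parent_in root_in)

lemma parent_less: "v \<in> V \<Longrightarrow> v \<noteq> root \<Longrightarrow> (p v, v) \<in> R - Id"
  using parent_le parent_fixed by auto

text \<open>Descending along parents reaches the root after finitely many steps, since the order has no
  infinite descending sequence.\<close>

lemma root_ancestor: "v \<in> V \<Longrightarrow> \<exists>n. (p ^^ n) v = root"
proof (induction v rule: wf_induct_rule[OF less_wf])
  case (1 v)
  show ?case
  proof (cases "v = root")
    case True
    then show ?thesis by (metis funpow_0)
  next
    case False
    then obtain n where "(p ^^ n) (p v) = root"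
      using 1 parent_less parent_in by blast
    then have "(p ^^ Suc n) v = root" by (simp only: funpow_Suc_right o_apply)
    then show ?thesis by blast
  qed
qed

lemma finite_ancestors:
  assumes "v \<in> V"
  shows "finite (range (\<lambda>m. (p ^^ m) v))"
proof -
  obtain n where n: "(p ^^ n) v = root" using root_ancestor[OF assms] by blast
  have root: "(p ^^ i) root = root" for i
    by (induction i) (simp_all add: parent_root)
  have "(p ^^ m) v \<in> (\<lambda>m. (p ^^ m) v) ` {..n}" for m
  proof (cases "m \<le> n")
    case False
    then have "(p ^^ m) v = (p ^^ (m - n)) ((p ^^ n) v)"
      by (metis funpow_add le_add_diff_inverse2 nat_le_linear o_apply)
    then have "(p ^^ m) v = (p ^^ n) v" using n root by simp
    then show ?thesis by simp
  qed simp
  then have "range (\<lambda>m. (p ^^ m) v) \<subseteq> (\<lambda>m. (p ^^ m) v) ` {..n}" by blast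
  then show ?thesis by (rule finite_subset) simp
qed

text \<open>As long as \<open>y\<close> is larger than its neighbour \<open>x\<close>, the parent of \<open>y\<close> is still adjacent to \<open>x\<close>.
  Minimality of \<open>j\<close> makes \<open>(p ^^ j) y\<close> the first ancestor of \<open>y\<close> that is at most \<open>x\<close>.\<close>

lemma descend_below_neighbour:
  assumes "(x, y) \<in> E"
  shows "\<exists>j. ((p ^^ j) y, x) \<in> R \<and> (x, (p ^^ j) y) \<in> E \<and> (\<forall>i<j. (x, (p ^^ i) y) \<in> R - Id)"
  using assms
proof (induction y rule: wf_induct_rule[OF less_wf])
  case (1 y)
  have in_V: "x \<in> V" "y \<in> V" using 1(2) edge_in by auto
  show ?case
  proof (cases "(y, x) \<in> R")
    case True
    then show ?thesis using 1(2) by (intro exI[of _ 0]) simp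
  next
    case False
    then have less: "(x, y) \<in> R - Id" using not_le in_V by blast
    then have "y \<noteq> root" using root_least in_V le_antisym by blast
    moreover have "(x, p y) \<in> E"
      using parent_dominates edge_sym 1(2) less in_V by blast
    ultimately obtain j where j: "((p ^^ j) (p y), x) \<in> R" "(x, (p ^^ j) (p y)) \<in> E"
        "\<forall>i<j. (x, (p ^^ i) (p y)) \<in> R - Id"
      using 1(1) parent_less in_V by blast
    have "(x, (p ^^ i) y) \<in> R - Id" if "i < Suc j" for i
      using that less j(3) by (cases i) (simp_all add: funpow_Suc_right del: funpow.simps(2))
    with j(1,2) show ?thesis
      by (intro exI[of _ "Suc j"]) (simp add: funpow_Suc_right del: funpow.simps(2))
  qed
qed

text \<open>Mapping every vertex to its first ancestor that is at most \<open>(p ^^ i) x\<close> is a graph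
  homomorphism; here this is stated for an edge at \<open>x\<close>. The two ends of the edge descend in turn,
  always the larger one, so that domination keeps them adjacent.\<close>

lemma shadow_adjacent:
  assumes "(x, y) \<in> E"
  shows "\<exists>j. ((p ^^ j) y, (p ^^ i) x) \<in> R \<and> ((p ^^ i) x, (p ^^ j) y) \<in> E \<and>
    (\<forall>l<j. ((p ^^ i) x, (p ^^ l) y) \<in> R - Id)"
proof (induction i)
  case 0
  show ?case unfolding funpow_0 by (rule descend_below_neighbour[OF assms])
next
  case (Suc i)
  define a where "a = (p ^^ i) x"
  have a: "a \<in> V" unfolding a_def using edge_in[OF assms] ancestor_in by simp
  obtain j where j: "((p ^^ j) y, a) \<in> R" "(a, (p ^^ j) y) \<in> E"
      "\<forall>l<j. (a, (p ^^ l) y) \<in> R - Id"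
    using Suc[folded a_def] by blast
  have "(p a, (p ^^ j) y) \<in> E" using parent_dominates j a by blast
  from descend_below_neighbour[OF this] obtain k where
    k: "((p ^^ k) ((p ^^ j) y), p a) \<in> R" "(p a, (p ^^ k) ((p ^^ j) y)) \<in> E"
      "\<forall>l<k. (p a, (p ^^ l) ((p ^^ j) y)) \<in> R - Id"
    by blast
  have "(p a, (p ^^ l) y) \<in> R - Id" if l: "l < k + j" for l
  proof (cases "l < j")
    case True
    then show ?thesis using j(3) le_less_trans parent_le[OF a] by blast
  next
    case False
    then obtain m where "l = m + j" by (metis add.commute le_Suc_ex not_less)
    then show ?thesis using k(3) l by (simp add: funpow_add)
  qed
  then show ?case using k(1,2) unfolding a_def
    by (intro exI[of _ "k + j"]) (simp add: funpow_add)
qed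

definition reachable :: "'a \<Rightarrow> 'a \<Rightarrow> bool" where
  "reachable c r \<longleftrightarrow> (\<exists>n. (c, (p ^^ n) r) \<in> E)"

definition gap :: "'a \<Rightarrow> 'a \<Rightarrow> nat" where
  "gap c r = (LEAST n. (c, (p ^^ n) r) \<in> E)"

text \<open>The strategy has to be legal at every pair of positions. Staying put is a default for pairs
  without a reachable ancestor, which do not arise before capture when the cop starts at the root.\<close>

definition chase :: "'a \<times> 'a \<Rightarrow> 'a" where
  "chase = (\<lambda>(c, r). if reachable c r then (p ^^ gap c r) r else c)"

text \<open>The child of the cop's position after her move, on the chain towards \<open>r\<close>. When she catches
  the robber, \<open>gap c r = 0\<close>, and there is no such child.\<close>

definition front :: "'a \<Rightarrow> 'a \<Rightarrow> 'a" where
  "front c r = (p ^^ (gap c r - 1)) r"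

lemma gap_edge: "reachable c r \<Longrightarrow> (c, (p ^^ gap c r) r) \<in> E"
  unfolding reachable_def gap_def by (rule LeastI_ex)

lemma chase_is_strategy: "cop_strategy V E root chase"
  unfolding cop_strategy_def chase_def
  by (auto simp: root_in gap_edge edge_refl)

lemma root_reachable: "r \<in> V \<Longrightarrow> reachable root r"
  unfolding reachable_def using root_ancestor edge_refl[OF root_in] by metis

text \<open>This is where domination by the cop's position is used: the first ancestor of \<open>r'\<close> that is at
  most the front is adjacent to the front, hence to the parent of the front.\<close>

lemma front_advances:
  assumes reach: "reachable c r" and move: "(r, r') \<in> E" and free: "chase (c, r) \<noteq> r"
  shows "reachable (chase (c, r)) r'"
    and "chase (chase (c, r), r') \<noteq> r' \<Longrightarrow> (front c r, front (chase (c, r)) r') \<in> R - Id"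
proof -
  define a where "a = front c r"
  have "gap c r \<noteq> 0" using reach free by (intro notI) (simp add: chase_def)
  then have cop: "chase (c, r) = p a"
    using reach by (cases "gap c r") (simp_all add: chase_def front_def a_def)
  have a: "a \<in> V" unfolding a_def front_def using move edge_in ancestor_in by blast
  obtain j where j: "((p ^^ j) r', a) \<in> R" "(a, (p ^^ j) r') \<in> E"
      "\<forall>l<j. (a, (p ^^ l) r') \<in> R - Id"
    using shadow_adjacent[OF move, of "gap c r - 1"] unfolding a_def front_def by blast
  have edge: "(p a, (p ^^ j) r') \<in> E" using parent_dominates a j by blast
  then show reach': "reachable (chase (c, r)) r'" unfolding cop reachable_def by blast
  assume "chase (chase (c, r), r') \<noteq> r'"
  then have "gap (p a) r' \<noteq> 0" using reach' unfolding cop by (intro notI) (simp add: chase_def)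
  moreover have "gap (p a) r' \<le> j" unfolding gap_def using edge by (rule Least_le)
  ultimately have "gap (p a) r' - 1 < j" by simp
  then show "(front c r, front (chase (c, r)) r') \<in> R - Id"
    unfolding cop using j(3) by (simp add: a_def front_def)
qed

theorem chase_weakly_winning: "weakly_winning V E root chase"
  unfolding weakly_winning_def
proof (intro allI impI)
  fix c r
  assume "play_following V E root chase c r"
  then have play: "c 0 = root" "c (Suc k) = chase (c k, r k)" "r 0 \<in> V" "(r k, r (Suc k)) \<in> E" for k
    by (auto simp: play_following_def)
  show "caught c r \<or> (\<forall>v\<in>V. finite {k. r k = v})"
    unfolding disj_imp
  proof
    assume "\<not> caught c r"
    then have free: "chase (c k, r k) \<noteq> r k" for k
      using play(2) by (metis caught_def)
    have reach: "reachable (c k) (r k)" for k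
    proof (induction k)
      case 0
      show ?case using root_reachable play by simp
    next
      case (Suc k)
      show ?case using front_advances(1)[OF Suc play(4) free] by (simp add: play(2))
    qed
    define \<alpha> where "\<alpha> k = front (c k) (r k)" for k
    have step: "(\<alpha> k, \<alpha> (Suc k)) \<in> R - Id" for k
      using front_advances(2)[OF reach play(4) free] free[of "Suc k"]
      by (simp add: \<alpha>_def play(2))
    have "(\<alpha> k, \<alpha> l) \<in> R - Id" if "k < l" for k l
      using that by (induction rule: less_Suc_induct) (use step less_trans in blast)+
    then have "inj \<alpha>" by (intro linorder_injI) blast
    show "\<forall>v\<in>V. finite {k. r k = v}"
    proof
      fix v assume "v \<in> V"
      moreover have "\<alpha> ` {k. r k = v} \<subseteq> range (\<lambda>m. (p ^^ m) v)"
        by (auto simp: \<alpha>_def front_def)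
      ultimately have "finite (\<alpha> ` {k. r k = v})"
        using finite_ancestors finite_subset by blast
      then show "finite {k. r k = v}"
        using \<open>inj \<alpha>\<close> by (meson finite_imageD inj_on_subset subset_UNIV)
    qed
  qed
qed

end

lemma constructible_domination_tree:
  assumes graph: "graph V E" and "constructible V E"
  obtains R root p where "domination_tree V E R root p"
proof -
  obtain R where R: "well_order_on V R" and
    dom: "\<And>v. v \<in> V \<Longrightarrow> \<not> (\<forall>w\<in>V. (v, w) \<in> R) \<Longrightarrow>
      \<exists>u\<in>down_set V R v. dominates (down_set V R v) (induced_edges E (down_set V R v)) u v"
    using assms(2) unfolding constructible_def by blast
  have refl: "(v, v) \<in> R" if "v \<in> V" for v
    using R that unfolding order_on_defs refl_on_def by blast
  have antisym: "x = y" if "(x, y) \<in> R" "(y, x) \<in> R" for x y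
    using R that unfolding order_on_defs by (blast dest: antisymD)
  have total: "(x, y) \<in> R" if "x \<in> V" "y \<in> V" "(y, x) \<notin> R" for x y
    using R that refl[OF that(1)] unfolding well_order_on_def linear_order_on_def total_on_def by metis
  have wf: "wf (R - Id)" using R by (simp add: well_order_on_def)
  have "V \<noteq> {}" using graph by (simp add: graph_def)
  then obtain root where root: "root \<in> V" "\<forall>y. (y, root) \<in> R - Id \<longrightarrow> y \<notin> V"
    using wf by (metis wf_eq_minimal ex_in_conv)
  have least: "(root, v) \<in> R" if "v \<in> V" for v
    using root total refl that by blast
  have "\<exists>u. (u, v) \<in> R \<and> u \<noteq> v \<and> (\<forall>w. (v, w) \<in> E \<longrightarrow> (w, v) \<in> R \<longrightarrow> (u, w) \<in> E)"
    if v: "v \<in> V" "v \<noteq> root" for v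
  proof -
    have "\<not> (\<forall>w\<in>V. (v, w) \<in> R)" using antisym least root v by blast
    then obtain u where "dominates (down_set V R v) (induced_edges E (down_set V R v)) u v"
      using dom v by blast
    moreover have "E \<subseteq> V \<times> V" using graph by (simp add: graph_def)
    ultimately show ?thesis
      unfolding dominates_def down_set_def induced_edges_def using refl v by blast
  qed
  then obtain q where q: "\<And>v. v \<in> V \<Longrightarrow> v \<noteq> root \<Longrightarrow>
      (q v, v) \<in> R \<and> q v \<noteq> v \<and> (\<forall>w. (v, w) \<in> E \<longrightarrow> (w, v) \<in> R \<longrightarrow> (q v, w) \<in> E)"
    by metis
  have "domination_tree V E R root (\<lambda>v. if v = root then root else q v)"
  proof (unfold_locales, goal_cases)
    case (5 v)
    then show ?case using q refl[OF root(1)] by simp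
  next
    case (6 v)
    then show ?case using q by (metis (full_types))
  next
    case (7 v w)
    show ?case
    proof (cases "v = root")
      case True
      then show ?thesis using 7 by simp
    next
      case False
      then show ?thesis using q[OF 7(1)] 7 by simp
    qed
  qed (use graph R root(1) least in simp_all)
  then show ?thesis by (rule that)
qed

theorem theorem10:
  fixes V :: "'a set" and E :: "('a \<times> 'a) set"
  assumes "graph V E"
    and "constructible V E"
  shows "weakly_cop_win V E"
proof -
  obtain R root p where "domination_tree V E R root p"
    using constructible_domination_tree[OF assms] .
  then interpret domination_tree V E R root p .
  show ?thesis
    unfolding weakly_cop_win_def using chase_is_strategy chase_weakly_winning by blast
qed

end
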